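(* Let $\nu$ be a complex number that is not a negative integer. Then there exist polynomials $N^{(1)}_{n,\nu}(q)$, $n\ge1$, in $q$, $q^\nu$ and $[\nu]_q$ with nonnegative integer coefficients such that, as formal power series in $z$, \[ \frac{J^{(1)}_{\nu+1}((1-q)z;q)}{J^{(1)}_\nu((1-q)z;q)} = \sum_{n=1}^{\infty} \frac{N^{(1)}_{n,\nu}(q)}{D_{n,\nu}(q)} q^{(\nu+1)(n-1)} \left( \frac{z}{2} \right)^{2n-1}, \qquad D_{n,\nu}(q) = \prod_{k=1}^n [k+\nu]_q^{\lfloor n/k \rfloor}. \]
   Context: Notation: $(a;p)_n=(1-a)(1-ap)\cdots(1-ap^{n-1})$, $(a;p)_\infty=\prod_{i\ge0}(1-ap^i)$, $[x]_q=(1-q^x)/(1-q)$. Jackson's $q$-Bessel function with base $p$ is $J^{(1)}_\nu(w;p)=\frac{(p^{\nu+1};p)_\infty}{(p;p)_\infty}(w/2)^\nu\Psi_\nu(w;p)$, where $\Psi_\nu(w;p)=\sum_{n\ge0}\frac{(-w^2/4)^n}{(p;p)_n(p^{\nu+1};p)_n}$. Thus $\frac{J^{(1)}_{\nu+1}(w;p)}{J^{(1)}_\nu(w;p)}=\frac{w/2}{1-p^{\nu+1}}\frac{\Psi_{\nu+1}(w;p)}{\Psi_\nu(w;p)}$, a formal power series in $w$. *)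

theory Defs
  imports
    "HOL-Analysis.Analysis"
    "HOL-Computational_Algebra.Formal_Power_Series"
    "HOL-Library.Poly_Mapping"
begin

text \<open>Powers with complex exponents are \<open>q powr x = exp (x * Ln q)\<close>, the principal branch.\<close>

definition q_number :: "complex \<Rightarrow> complex \<Rightarrow> complex" where
  "q_number q x = (1 - q powr x) / (1 - q)"

definition q_pochhammer :: "complex \<Rightarrow> complex \<Rightarrow> nat \<Rightarrow> complex" where
  "q_pochhammer a p n = (\<Prod>i<n. 1 - a * p ^ i)"

definition q_pochhammer_inf :: "complex \<Rightarrow> complex \<Rightarrow> complex" where
  "q_pochhammer_inf a p = prodinf (\<lambda>i. 1 - a * p ^ i)"

text \<open>The power series \<open>\<Psi>\<^sub>\<nu>(w; p)\<close> in the variable \<open>w\<close>: the series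
  \<open>\<Sum>\<^sub>n u\<^sup>n / ((p;p)\<^sub>n (p\<^bsup>\<nu>+1\<^esup>;p)\<^sub>n)\<close> with \<open>u = - w\<^sup>2 / 4\<close> substituted.\<close>

definition Psi :: "complex \<Rightarrow> complex \<Rightarrow> complex fps" where
  "Psi \<nu> p =
     Abs_fps (\<lambda>n. 1 / (q_pochhammer p p n * q_pochhammer (p powr (\<nu> + 1)) p n))
       oo (fps_const (- 1 / 4) * fps_X ^ 2)"

text \<open>Jackson's first \<open>q\<close>-Bessel function is \<open>(w/2)\<^sup>\<nu>\<close> times a power series in \<open>w\<close>.
  For general \<open>\<nu>\<close> the factor \<open>(w/2)\<^sup>\<nu>\<close> is not itself a formal power series, so
  \<open>jackson1_series \<nu> p\<close> is the cofactor \<open>J\<^sub>\<nu>(w; p) / (w/2)\<^sup>\<nu>\<close>. In the quotient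
  \<open>J\<^bsub>\<nu>+1\<^esub>(w; p) / J\<^sub>\<nu>(w; p)\<close> the factors \<open>(w/2)\<^bsup>\<nu>+1\<^esup>\<close> and \<open>(w/2)\<^sup>\<nu>\<close> leave \<open>w/2\<close>.\<close>

definition jackson1_series :: "complex \<Rightarrow> complex \<Rightarrow> complex fps" where
  "jackson1_series \<nu> p =
     fps_const (q_pochhammer_inf (p powr (\<nu> + 1)) p / q_pochhammer_inf p p) * Psi \<nu> p"

definition jackson1_ratio :: "complex \<Rightarrow> complex \<Rightarrow> complex fps" where
  "jackson1_ratio \<nu> p =
     (fps_const (1 / 2) * fps_X) * (jackson1_series (\<nu> + 1) p / jackson1_series \<nu> p)"

definition D_denom :: "complex \<Rightarrow> complex \<Rightarrow> nat \<Rightarrow> complex" where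
  "D_denom \<nu> q n = (\<Prod>k=1..n. q_number q (of_nat k + \<nu>) ^ (n div k))"

text \<open>Polynomials in three variables with nonnegative integer coefficients are finitely
  supported maps from exponent triples to \<open>nat\<close>.\<close>

definition eval3 :: "(nat \<times> nat \<times> nat \<Rightarrow>\<^sub>0 nat) \<Rightarrow> complex \<Rightarrow> complex \<Rightarrow> complex \<Rightarrow> complex" where
  "eval3 P x y t =
     (\<Sum>(i, j, k) \<in> Poly_Mapping.keys P.
        of_nat (Poly_Mapping.lookup P (i, j, k)) * x ^ i * y ^ j * t ^ k)"

end

theory Submission
  imports Defs
begin

text \<open>Put \<open>a = q\<^bsup>\<nu>+1\<^esup>\<close> and let \<open>F\<^sub>a(u) = \<Sum> u\<^sup>n / ((q;q)\<^sub>n (a;q)\<^sub>n)\<close>. The contiguous relations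
  \<open>F\<^sub>a(u) - F\<^sub>a(qu) = u F\<^bsub>aq\<^esub>(u) / (1 - a)\<close> and \<open>(1 - a) F\<^sub>a(u) = F\<^bsub>aq\<^esub>(u) - a F\<^bsub>aq\<^esub>(qu)\<close> yield a
  Riccati type \<open>q\<close>-difference equation for \<open>F\<^bsub>aq\<^esub> / F\<^sub>a\<close>. Writing the coefficient of
  \<open>(z/2)\<^bsup>2n-1\<^esup>\<close> of the Bessel quotient as \<open>a\<^bsup>n-1\<^esup> b\<^sub>n\<close>, that equation becomes
  \<open>[n+\<nu>] b\<^sub>n = \<Sum>\<^bsub>0<k<n\<^esub> q\<^bsup>n-k-1\<^esup> b\<^sub>k b\<^bsub>n-k\<^esub>\<close> with \<open>b\<^sub>1 = 1/[1+\<nu>]\<close>. Since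
  \<open>\<lfloor>k/j\<rfloor> + \<lfloor>(n-k)/j\<rfloor> \<le> \<lfloor>n/j\<rfloor>\<close>, multiplying by the common denominator leaves a recurrence for the
  numerators with coefficients that are products of \<open>[j+\<nu>] = 1 + q + \<dots> + q\<^bsup>j-1\<^esup> + q\<^sup>j [\<nu>]\<close>.\<close>

unbundle no vec_syntax
unbundle fps_syntax

section \<open>Polynomial functions with natural coefficients\<close>

text \<open>Membership is stated through the induced function, so that closure under sums and
  products replaces computation with finitely supported maps. One \<open>P\<close> must serve all
  arguments.\<close>

definition nat_poly3 :: "(complex \<Rightarrow> complex \<Rightarrow> complex \<Rightarrow> complex) \<Rightarrow> bool" where
  "nat_poly3 f \<longleftrightarrow> (\<exists>P. \<forall>x y t. eval3 P x y t = f x y t)"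

lemma eval3_add: "eval3 (P + Q) x y t = eval3 P x y t + eval3 Q x y t"
proof -
  \<comment> \<open>Distributivity of a sum over keys needs a summand additive in the coefficient;
    \<open>h\<close> isolates the coefficient for this.\<close>
  define h where "h = (\<lambda>(i, j, k) (c::nat). of_nat c * x ^ i * y ^ j * t ^ k :: complex)"
  have *: "eval3 P x y t = (\<Sum>m\<in>Poly_Mapping.keys P. h m (Poly_Mapping.lookup P m))" for P
    unfolding eval3_def h_def by (rule sum.cong) auto
  show ?thesis
    unfolding * by (rule setsum_keys_plus_distrib) (auto simp: h_def algebra_simps)
qed

lemma nat_poly3_monomial: "nat_poly3 (\<lambda>x y t. of_nat c * x ^ i * y ^ j * t ^ k)"
  unfolding nat_poly3_def
  by (rule exI[of _ "Poly_Mapping.single (i, j, k) c"]) (simp add: eval3_def)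

lemma nat_poly3_add:
  "nat_poly3 f \<Longrightarrow> nat_poly3 g \<Longrightarrow> nat_poly3 (\<lambda>x y t. f x y t + g x y t)"
  unfolding nat_poly3_def by (metis eval3_add)

lemma nat_poly3_of_nat: "nat_poly3 (\<lambda>x y t. of_nat c)"
  using nat_poly3_monomial[of c 0 0 0] by simp

lemma nat_poly3_power1: "nat_poly3 (\<lambda>x y t. x ^ i)"
  using nat_poly3_monomial[of 1 i 0 0] by simp

lemma nat_poly3_var3: "nat_poly3 (\<lambda>x y t. t)"
  using nat_poly3_monomial[of 1 0 0 1] by simp

lemma nat_poly3_sum:
  "(\<And>s. s \<in> S \<Longrightarrow> nat_poly3 (f s)) \<Longrightarrow> nat_poly3 (\<lambda>x y t. \<Sum>s\<in>S. f s x y t)"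
proof (induction S rule: infinite_finite_induct)
  case (insert s S)
  then show ?case by (auto intro: nat_poly3_add)
qed (use nat_poly3_of_nat[of 0] in simp_all)

lemma nat_poly3_mult:
  assumes "nat_poly3 f" "nat_poly3 g"
  shows "nat_poly3 (\<lambda>x y t. f x y t * g x y t)"
proof -
  obtain P Q where P: "\<And>x y t. f x y t = eval3 P x y t" and Q: "\<And>x y t. g x y t = eval3 Q x y t"
    using assms unfolding nat_poly3_def by metis
  define h where "h = (\<lambda>m m' (x::complex) (y::complex) (t::complex).
     case (m, m') of ((i, j, k), (i', j', k')) \<Rightarrow>
     of_nat (Poly_Mapping.lookup P m * Poly_Mapping.lookup Q m')
       * x ^ (i + i') * y ^ (j + j') * t ^ (k + k'))"
  have "f x y t * g x y t
      = (\<Sum>m\<in>Poly_Mapping.keys P. \<Sum>m'\<in>Poly_Mapping.keys Q. h m m' x y t)" for x y t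
    unfolding P Q eval3_def sum_product h_def
    by (intro sum.cong refl) (auto simp: power_add mult_ac)
  moreover have "nat_poly3 (h m m')" for m m'
    unfolding h_def by (cases m; cases m') (simp add: nat_poly3_monomial del: of_nat_mult)
  ultimately show ?thesis
    by (simp add: nat_poly3_sum)
qed

lemma nat_poly3_power: "nat_poly3 f \<Longrightarrow> nat_poly3 (\<lambda>x y t. f x y t ^ n)"
proof (induction n)
  case 0
  show ?case using nat_poly3_of_nat[of 1] by simp
next
  case (Suc n)
  then show ?case unfolding power_Suc by (intro nat_poly3_mult)
qed

lemma nat_poly3_prod:
  "(\<And>s. s \<in> S \<Longrightarrow> nat_poly3 (f s)) \<Longrightarrow> nat_poly3 (\<lambda>x y t. \<Prod>s\<in>S. f s x y t)"
proof (induction S rule: infinite_finite_induct)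
  case (insert s S)
  then show ?case by (auto intro: nat_poly3_mult)
qed (use nat_poly3_of_nat[of 1] in simp_all)

section \<open>The convolution recurrence\<close>

text \<open>For \<open>x = q\<close> and \<open>t = [\<nu>]\<close> this is \<open>[j+\<nu>]\<close>.\<close>

definition q_shift :: "nat \<Rightarrow> complex \<Rightarrow> complex \<Rightarrow> complex" where
  "q_shift j x t = (\<Sum>i<j. x ^ i) + x ^ j * t"

text \<open>The natural subtractions in the exponent never truncate, by superadditivity of the
  floor. The product stops before \<open>n\<close> because the factor for \<open>j = n\<close> comes
  from the left side of the recurrence. Only \<open>n \<ge> 1\<close> matters later; the value at 0
  is a filler.\<close>

fun kishore_num :: "nat \<Rightarrow> complex \<Rightarrow> complex \<Rightarrow> complex" where
  "kishore_num n x t =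
    (if n \<le> 1 then 1
     else \<Sum>k\<in>{1..<n}. x ^ (n - k - 1) * kishore_num k x t * kishore_num (n - k) x t
            * (\<Prod>j\<in>{1..<n}. q_shift j x t ^ (n div j - k div j - (n - k) div j)))"

declare kishore_num.simps [simp del]

lemma nat_poly3_kishore_num: "nat_poly3 (\<lambda>x y t. kishore_num n x t)"
proof (induction n rule: less_induct)
  case (less n)
  show ?case
  proof (cases "n \<le> 1")
    case True
    then show ?thesis
      using nat_poly3_of_nat[of 1] by (simp add: kishore_num.simps[of n])
  next
    case False
    then have eq: "(\<lambda>x y t. kishore_num n x t) =
      (\<lambda>x y t. \<Sum>k\<in>{1..<n}. x ^ (n - k - 1) * kishore_num k x t * kishore_num (n - k) x t
            * (\<Prod>j\<in>{1..<n}. q_shift j x t ^ (n div j - k div j - (n - k) div j)))"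
      by (simp add: kishore_num.simps[of n])
    show ?thesis
      unfolding eq q_shift_def
      by (intro nat_poly3_sum nat_poly3_mult nat_poly3_prod nat_poly3_power nat_poly3_add
          nat_poly3_power1 nat_poly3_var3 less.IH) auto
  qed
qed

lemma div_add_div_le: "k div j + l div j \<le> (k + l) div (j::nat)"
  by (subst div_add1_eq) simp

text \<open>With \<open>D n\<close> the claimed denominator, \<open>D n / (D k * D (n - k))\<close>
  is \<open>q_shift n x t\<close> times the product in \<open>kishore_num\<close>. Clearing
  denominators thus leaves \<open>q_shift n x t\<close> in every summand, where it cancels against
  the left side.\<close>

lemma kishore_recurrence:
  fixes b :: "nat \<Rightarrow> complex"
  assumes nz: "\<And>j. j \<ge> 1 \<Longrightarrow> q_shift j x t \<noteq> 0"
    and b1: "q_shift 1 x t * b 1 = 1"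
    and rec: "\<And>n. n \<ge> 2 \<Longrightarrow>
      q_shift n x t * b n = (\<Sum>k\<in>{1..<n}. x ^ (n - k - 1) * b k * b (n - k))"
    and "n \<ge> 1"
  shows "b n = kishore_num n x t / (\<Prod>k=1..n. q_shift k x t ^ (n div k))"
  using \<open>n \<ge> 1\<close>
proof (induction n rule: less_induct)
  case (less n)
  define D where "D n = (\<Prod>k=1..n. q_shift k x t ^ (n div k))" for n
  define E where "E k = (\<Prod>j\<in>{1..<n}. q_shift j x t ^ (n div j - k div j - (n - k) div j))" for k
  have Dnz: "D m \<noteq> 0" for m
    unfolding D_def using nz by auto
  show ?case
  proof (cases "n = 1")
    case True
    then show ?thesis
      using b1 nz[of 1] by (simp add: kishore_num.simps[of "Suc 0"] field_simps)
  next
    case False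
    with less.prems have n2: "n \<ge> 2" by simp
    \<comment> \<open>Factors with \<open>j > k\<close> have exponent \<open>k div j = 0\<close>, so
      all these products can share one index set.\<close>
    have Dext: "D k = (\<Prod>j\<in>{1..<n}. q_shift j x t ^ (k div j))" if "k < n" for k
      unfolding D_def using that by (intro prod.mono_neutral_left) auto
    have Dn: "D n = q_shift n x t * (\<Prod>j\<in>{1..<n}. q_shift j x t ^ (n div j))"
    proof -
      have "{1..n} = insert n {1..<n}" using n2 by auto
      then show ?thesis unfolding D_def using n2 by simp
    qed
    have E: "E k * D k * D (n - k) = (\<Prod>j\<in>{1..<n}. q_shift j x t ^ (n div j))"
      if "k \<in> {1..<n}" for k
    proof -
      have "(n div j - k div j - (n - k) div j) + k div j + (n - k) div j = n div j" for j
        using div_add_div_le[of k j "n - k"] that by simp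
      then show ?thesis
        unfolding E_def using that
        by (simp add: Dext prod.distrib[symmetric] power_add[symmetric])
    qed
    have "q_shift n x t * (b n * D n)
        = (\<Sum>k\<in>{1..<n}. x ^ (n - k - 1) * b k * b (n - k)) * D n"
      using rec[OF n2] by simp
    also have "\<dots> = (\<Sum>k\<in>{1..<n}. q_shift n x t *
        (x ^ (n - k - 1) * kishore_num k x t * kishore_num (n - k) x t * E k))"
      unfolding sum_distrib_right
    proof (rule sum.cong[OF refl])
      fix k assume k: "k \<in> {1..<n}"
      have "b k = kishore_num k x t / D k" "b (n - k) = kishore_num (n - k) x t / D (n - k)"
        using k less.IH[of k] less.IH[of "n - k"] by (auto simp: D_def)
      moreover have "D n = q_shift n x t * (E k * D k * D (n - k))"
        using E[OF k] Dn by simp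
      ultimately show "x ^ (n - k - 1) * b k * b (n - k) * D n = q_shift n x t *
          (x ^ (n - k - 1) * kishore_num k x t * kishore_num (n - k) x t * E k)"
        using Dnz[of k] Dnz[of "n - k"] by simp
    qed
    also have "\<dots> = q_shift n x t * kishore_num n x t"
      using n2 by (simp add: kishore_num.simps[of n] E_def sum_distrib_left)
    finally have "b n * D n = kishore_num n x t"
      using nz[of n] n2 by simp
    then show ?thesis
      using Dnz[of n] unfolding D_def[symmetric] by (simp add: field_simps)
  qed
qed

section \<open>Formal power series\<close>

lemma fps_compose_linear_nth:
  "(f oo (fps_const c * fps_X)) $ n = c ^ n * (f $ n :: 'a::comm_ring_1)"
proof -
  have "(f oo (fps_const c * fps_X)) $ n = (\<Sum>i=0..n. f $ i * (c ^ i * (if n = i then 1 else 0)))"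
    by (simp add: fps_compose_nth power_mult_distrib fps_const_power)
  also have "\<dots> = (\<Sum>i\<in>{n}. f $ i * (c ^ i * (if n = i then 1 else 0)))"
    by (rule sum.mono_neutral_right) auto
  finally show ?thesis by (simp add: mult.commute)
qed

text \<open>As \<open>g ^ m\<close> has no terms below order \<open>m\<close>, coefficient
  \<open>n\<close> of the partial sums is constant once \<open>N > n\<close>.\<close>

lemma fps_sums_compose_mult:
  fixes g h :: "'a::comm_ring_1 fps"
  assumes "g $ 0 = 0"
  shows "(\<lambda>m. fps_const (c m) * g ^ m * h) sums ((Abs_fps c oo g) * h)"
  unfolding sums_def
proof (rule tendsto_fpsI)
  fix n
  have "(\<Sum>m<N. fps_const (c m) * g ^ m * h) $ n = ((Abs_fps c oo g) * h) $ n" if "N > n" for N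
  proof -
    have "(\<Sum>m<N. fps_const (c m) * g ^ m) $ i = (Abs_fps c oo g) $ i" if "i \<le> n" for i
      unfolding fps_sum_nth fps_compose_nth using assms that \<open>N > n\<close>
      by (intro sum.mono_neutral_cong_right) (auto simp: startsby_zero_power_prefix)
    then show ?thesis
      by (simp add: sum_distrib_right[symmetric] fps_mult_nth)
  qed
  then show "eventually (\<lambda>N. (\<Sum>m<N. fps_const (c m) * g ^ m * h) $ n
      = ((Abs_fps c oo g) * h) $ n) sequentially"
    using eventually_gt_at_top[of n] by (rule eventually_mono[rotated]) auto
qed

section \<open>The Bessel quotient\<close>

text \<open>This is \<open>Psi\<close> before the substitution u = -w^2/4, with a free parameter in
  place of q^(\<nu>+1): raising \<nu> by 1 becomes replacing \<open>a\<close> by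
  \<open>a * q\<close>.\<close>

definition bessel_fps :: "complex \<Rightarrow> complex \<Rightarrow> complex fps" where
  "bessel_fps a q = Abs_fps (\<lambda>n. 1 / (q_pochhammer q q n * q_pochhammer a q n))"

lemma q_pochhammer_Suc: "q_pochhammer a q (Suc n) = q_pochhammer a q n * (1 - a * q ^ n)"
  by (simp add: q_pochhammer_def)

lemma q_pochhammer_Suc_shift: "q_pochhammer a q (Suc n) = (1 - a) * q_pochhammer (a * q) q n"
  unfolding q_pochhammer_def by (subst prod.lessThan_Suc_shift) (simp add: mult.assoc)

lemma q_power_neq_1: "norm q < 1 \<Longrightarrow> q * q ^ i \<noteq> (1::complex)"
  by (metis norm_one norm_power power_Suc power_less_one_iff norm_ge_zero order_less_irrefl
      zero_less_Suc)

context
  fixes a q :: complex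
  assumes q0: "q \<noteq> 0" and q1: "norm q < 1" and a: "\<And>i. a * q ^ i \<noteq> 1"
begin

lemma a_neq_1: "a \<noteq> 1"
  using a[of 0] by simp

lemma aq_neq_1: "a * q * q ^ i \<noteq> 1"
  using a[of "Suc i"] by (simp add: mult.assoc)

lemma q_pochhammer_nonzero:
  "q_pochhammer q q n \<noteq> 0" "q_pochhammer a q n \<noteq> 0" "q_pochhammer (a * q) q n \<noteq> 0"
  using q_power_neq_1[OF q1] a aq_neq_1 unfolding q_pochhammer_def by auto

text \<open>In coefficient n, the factor 1 - q^n removes the last factor of (q;q)_n, while (a;q)_n =
  (1-a) (aq;q)_(n-1) shifts the parameter.\<close>

lemma bessel_fps_dilate:
  "bessel_fps a q - (bessel_fps a q oo (fps_const q * fps_X))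
     = fps_const (1 / (1 - a)) * fps_X * bessel_fps (a * q) q"
proof (rule fps_ext)
  fix n
  show "(bessel_fps a q - (bessel_fps a q oo (fps_const q * fps_X))) $ n
     = (fps_const (1 / (1 - a)) * fps_X * bessel_fps (a * q) q) $ n"
  proof (cases n)
    case 0
    then show ?thesis by (simp add: mult.assoc)
  next
    case (Suc m)
    have "1 - q * q ^ m \<noteq> 0" using q_power_neq_1[OF q1] by simp
    then have "1 / (P * (1 - q * q ^ m) * (A * B)) - q ^ Suc m * (1 / (P * (1 - q * q ^ m) * (A * B)))
        = 1 / A * (1 / (P * B))" if "P \<noteq> 0" "A \<noteq> 0" "B \<noteq> 0" for P A B :: complex
      using that by (simp add: divide_simps)
    from this[of "q_pochhammer q q m" "1 - a" "q_pochhammer (a * q) q m"]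
    show ?thesis
      unfolding Suc using a_neq_1 q_pochhammer_nonzero
      by (simp add: bessel_fps_def fps_compose_linear_nth mult.assoc q_pochhammer_Suc[of q]
          q_pochhammer_Suc_shift[of a])
  qed
qed

text \<open>Coefficientwise this is (a;q)_n (1 - a q^n) = (1-a) (aq;q)_n, both sides being
  (a;q)_(n+1).\<close>

lemma bessel_fps_raise:
  "fps_const (1 - a) * bessel_fps a q
     = bessel_fps (a * q) q - fps_const a * (bessel_fps (a * q) q oo (fps_const q * fps_X))"
proof (rule fps_ext)
  fix n
  have eq: "q_pochhammer a q n * (1 - a * q ^ n) = (1 - a) * q_pochhammer (a * q) q n"
    using q_pochhammer_Suc q_pochhammer_Suc_shift by metis
  have "(1 - a) * (1 / (P * A)) = 1 / (P * B) - a * (q ^ n * (1 / (P * B)))"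
    if "P \<noteq> 0" "A \<noteq> 0" "B \<noteq> 0" "A * (1 - a * q ^ n) = (1 - a) * B" for P A B :: complex
  proof -
    have "(1 - a) * (1 / (P * A)) = ((1 - a) * B) / (P * A * B)" using that by simp
    also have "\<dots> = (1 - a * q ^ n) / (P * B)" unfolding that(4)[symmetric] using that(1-3) by simp
    finally show ?thesis by (simp add: diff_divide_distrib)
  qed
  from this[OF q_pochhammer_nonzero eq]
  show "(fps_const (1 - a) * bessel_fps a q) $ n = (bessel_fps (a * q) q
      - fps_const a * (bessel_fps (a * q) q oo (fps_const q * fps_X))) $ n"
    by (simp add: bessel_fps_def fps_compose_linear_nth)
qed

lemma bessel_fps_nth_0: "bessel_fps c q $ 0 = 1"
  by (simp add: bessel_fps_def q_pochhammer_def)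

section \<open>The Riccati equation and its coefficients\<close>

definition bessel_ratio :: "complex fps" where
  "bessel_ratio = bessel_fps (a * q) q / bessel_fps a q"

text \<open>The denominator has constant term 1, hence is a unit and the division is exact.\<close>

lemma bessel_ratio_mult: "bessel_ratio * bessel_fps a q = bessel_fps (a * q) q"
  unfolding bessel_ratio_def
  by (rule dvd_div_mult_self) (simp add: fps_dvd_iff bessel_fps_nth_0 subdegree_eq_0_iff)

text \<open>Divide the raising relation by F_a. The term F_aq(qu) is R(qu) F_a(qu), and the dilation
  relation gives F_a(qu) / F_a(u) = 1 - u R(u) / (1-a). The proof multiplies by F_a and cancels it
  at the end.\<close>

lemma bessel_ratio_riccati:
  "bessel_ratio - fps_const a * (bessel_ratio oo (fps_const q * fps_X))
       * (1 - fps_const (1 / (1 - a)) * fps_X * bessel_ratio)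
     = fps_const (1 - a)"
proof -
  define A B R where "A = bessel_fps a q" "B = bessel_fps (a * q) q" "R = bessel_ratio"
  define A' B' R' where "A' = A oo (fps_const q * fps_X)" "B' = B oo (fps_const q * fps_X)"
    "R' = R oo (fps_const q * fps_X)"
  define C where "C = fps_const (1 / (1 - a)) * fps_X"
  have 1: "A - A' = C * B" and 2: "fps_const (1 - a) * A = B - fps_const a * B'" and 3: "R * A = B"
    using bessel_fps_dilate bessel_fps_raise bessel_ratio_mult
    by (simp_all add: A_B_R_def A'_B'_R'_def C_def)
  have 4: "R' * A' = B'"
    unfolding A'_B'_R'_def 3[symmetric] by (simp add: fps_compose_mult_distrib)
  have "A \<noteq> 0"
    using bessel_fps_nth_0[of a] unfolding A_B_R_def by auto
  have "(R - fps_const a * R' * (1 - C * R)) * A = R * A - fps_const a * (R' * (A * (1 - C * R)))"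
    by (simp add: algebra_simps)
  also have "A * (1 - C * R) = A - C * (R * A)"
    by (simp add: algebra_simps)
  also have "\<dots> = A'"
    unfolding 3 1[symmetric] by simp
  also have "R * A - fps_const a * (R' * A') = fps_const (1 - a) * A"
    unfolding 2 3 4 ..
  finally show ?thesis
    using \<open>A \<noteq> 0\<close> by (simp add: A_B_R_def A'_B'_R'_def C_def)
qed

lemma bessel_ratio_nth_0: "bessel_ratio $ 0 = 1"
  by (simp add: bessel_ratio_def bessel_fps_nth_0)

text \<open>In degree \<open>Suc m\<close> the linear terms R(u) - a R(qu) give the factor on the
  left. The quadratic term carries an extra \<open>fps_X\<close>, so it involves only coefficients
  up to \<open>m\<close>.\<close>

lemma bessel_ratio_nth_Suc:
  "(1 - a * q ^ Suc m) * bessel_ratio $ Suc m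
     = - (a / (1 - a)) * (\<Sum>i=0..m. q ^ (m - i) * bessel_ratio $ i * bessel_ratio $ (m - i))"
proof -
  define R R' where "R = bessel_ratio" "R' = bessel_ratio oo (fps_const q * fps_X)"
  have "R - fps_const a * R' + fps_const (a / (1 - a)) * (fps_X * (R * R')) = fps_const (1 - a)"
    using bessel_ratio_riccati unfolding R_R'_def
    by (simp add: algebra_simps fps_const_mult[symmetric] divide_inverse del: fps_const_mult)
  from arg_cong[OF this, of "\<lambda>f. f $ Suc m"]
  have "R $ Suc m - a * R' $ Suc m + a / (1 - a) * (R * R') $ m = 0"
    by simp
  moreover have "R' $ i = q ^ i * R $ i" for i
    unfolding R_R'_def by (rule fps_compose_linear_nth)
  ultimately have *: "(1 - a * q ^ Suc m) * R $ Suc m = - (a / (1 - a)) * (R * R') $ m"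
    by (simp add: algebra_simps)
  have "(R * R') $ m = (\<Sum>i=0..m. q ^ (m - i) * R $ i * R $ (m - i))"
    unfolding fps_mult_nth R_R'_def fps_compose_linear_nth by (simp add: mult_ac)
  with * show ?thesis by (simp add: R_R'_def)
qed

text \<open>Splitting off the first factor of (a;q)_inf gives the ratio. The products converge
  absolutely and have nonzero factors, so the normalising constant can be cancelled in the Bessel
  quotient.\<close>

lemma q_pochhammer_inf_ratio:
  "(q_pochhammer_inf (a * q) q / q_pochhammer_inf q q)
     = (q_pochhammer_inf a q / q_pochhammer_inf q q) / (1 - a)"
  "q_pochhammer_inf a q / q_pochhammer_inf q q \<noteq> 0"
proof -
  have conv: "convergent_prod (\<lambda>i. 1 - c * q ^ i)" for c
    by (intro abs_convergent_prod_imp_convergent_prod summable_imp_abs_convergent_prod)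
      (use q1 in \<open>simp add: norm_mult norm_power summable_mult summable_geometric\<close>)
  have "q_pochhammer_inf (a * q) q = q_pochhammer_inf a q / (1 - a)"
    unfolding q_pochhammer_inf_def
    using prodinf_split_head[OF conv, of a] a_neq_1 by (simp add: mult.assoc)
  then show "(q_pochhammer_inf (a * q) q / q_pochhammer_inf q q)
     = (q_pochhammer_inf a q / q_pochhammer_inf q q) / (1 - a)"
    by simp
  have "q_pochhammer_inf q q \<noteq> 0" "q_pochhammer_inf a q \<noteq> 0"
    unfolding q_pochhammer_inf_def
    by (rule prodinf_nonzero[OF conv]; use a q_power_neq_1[OF q1] in simp)+
  then show "q_pochhammer_inf a q / q_pochhammer_inf q q \<noteq> 0"
    by simp
qed

end

section \<open>Passage to Jackson's functions\<close>

lemma q_shift_q_number: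
  assumes "q \<noteq> 0" "q \<noteq> 1"
  shows "q_shift j q (q_number q \<nu>) = q_number q (of_nat j + \<nu>)"
proof -
  have "(\<Sum>i<j. q ^ i) = (1 - q ^ j) / (1 - q)"
    using assms by (simp add: sum_gp_strict)
  moreover have "q powr (of_nat j + \<nu>) = q ^ j * q powr \<nu>"
    using assms by (simp add: powr_add powr_nat')
  ultimately show ?thesis
    using assms by (simp add: q_shift_def q_number_def field_simps)
qed

text \<open>Putting w = (1-q) z turns -w^2/4 into -(1-q)^2 (z/2)^2 and w/2 into (1-q) (z/2); the
  infinite products contribute 1/(1-a).\<close>

lemma jackson1_ratio_compose:
  assumes q0: "q \<noteq> 0" and q1: "norm q < 1" and a: "\<And>i. q powr (\<nu> + 1) * q ^ i \<noteq> 1"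
  shows "jackson1_ratio \<nu> q oo (fps_const (1 - q) * fps_X)
    = fps_const ((1 - q) / (1 - q powr (\<nu> + 1)))
        * (bessel_ratio (q powr (\<nu> + 1)) q oo (fps_const (- ((1 - q)^2)) * (fps_const (1 / 2) * fps_X)^2))
        * (fps_const (1 / 2) * fps_X)"
proof -
  define a' where "a' = q powr (\<nu> + 1)"
  define g :: "complex fps" where "g = fps_const (- 1 / 4) * fps_X ^ 2"
  define h where "h = fps_const (1 - q) * fps_X"
  define R where "R = bessel_ratio a' q"
  note ctx = q0 q1 a[folded a'_def]
  have g0: "g $ 0 = 0" and h0: "h $ 0 = 0"
    by (simp_all add: g_def h_def)
  have a'q: "q powr (\<nu> + 1 + 1) = a' * q"
    using q0 by (simp add: a'_def powr_add power2_eq_square)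
  have const_div: "fps_const (c / (1 - a')) = fps_const (1 / (1 - a')) * fps_const c" for c
    by simp
  define K where "K = q_pochhammer_inf a' q / q_pochhammer_inf q q"
  have K: "q_pochhammer_inf (a' * q) q / q_pochhammer_inf q q = K / (1 - a')" "K \<noteq> 0"
    using q_pochhammer_inf_ratio[OF ctx] by (simp_all add: K_def)
  have J0: "jackson1_series \<nu> q = fps_const K * (bessel_fps a' q oo g)"
    by (simp add: jackson1_series_def Psi_def bessel_fps_def K_def g_def a'_def)
  have J1: "jackson1_series (\<nu> + 1) q = fps_const (K / (1 - a')) * (bessel_fps (a' * q) q oo g)"
    unfolding jackson1_series_def Psi_def a'q K(1) by (simp add: bessel_fps_def g_def)
  have "bessel_fps (a' * q) q oo g = (R oo g) * (bessel_fps a' q oo g)"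
    unfolding R_def bessel_ratio_mult[OF ctx, symmetric] by (rule fps_compose_mult_distrib[OF g0])
  then have "jackson1_series (\<nu> + 1) q = (fps_const (1 / (1 - a')) * (R oo g)) * jackson1_series \<nu> q"
    unfolding J0 J1 const_div[of K] by (simp only: mult_ac)
  moreover have "(bessel_fps a' q oo g) $ 0 = 1"
    by (simp add: bessel_fps_def q_pochhammer_def)
  then have "bessel_fps a' q oo g \<noteq> 0"
    by (intro notI) simp
  then have "jackson1_series \<nu> q \<noteq> 0"
    unfolding J0 using K(2) by auto
  ultimately have "jackson1_ratio \<nu> q = (fps_const (1 / 2) * fps_X) * (fps_const (1 / (1 - a')) * (R oo g))"
    by (simp add: jackson1_ratio_def)
  then have "jackson1_ratio \<nu> q oo h
      = (fps_const (1 / 2) * h) * (fps_const (1 / (1 - a')) * (R oo (g oo h)))"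
    by (simp add: fps_compose_mult_distrib h0 fps_compose_assoc[OF h0 g0])
  also have "g oo h = fps_const (- ((1 - q)^2)) * (fps_const (1 / 2) * fps_X)^2"
  proof -
    have "g oo h = fps_const (- 1 / 4) * h ^ 2"
      unfolding g_def by (simp only: fps_compose_mult_distrib[OF h0] fps_const_compose
          fps_X_power_compose[OF h0])
    moreover have "h ^ 2 = fps_const ((1 - q)^2) * fps_X ^ 2"
      by (simp add: h_def power_mult_distrib)
    moreover have "(fps_const (1 / 2) * fps_X)^2 = fps_const (1 / 4 :: complex) * fps_X ^ 2"
      by (simp add: power_mult_distrib power_divide)
    ultimately show ?thesis
      by (simp only: mult.assoc[symmetric] fps_const_mult) simp
  qed
  also have "fps_const (1 / 2) * h = fps_const (1 - q) * (fps_const (1 / 2) * fps_X)"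
    by (simp add: h_def mult_ac)
  finally show ?thesis
    unfolding h_def R_def a'_def[symmetric] const_div[of "1 - q"] by (simp only: mult_ac)
qed

theorem theorem3p2:
  fixes \<nu> :: complex
  assumes "\<And>k::nat. k \<ge> 1 \<Longrightarrow> \<nu> \<noteq> - of_nat k"
  shows "\<exists>N :: nat \<Rightarrow> (nat \<times> nat \<times> nat \<Rightarrow>\<^sub>0 nat).
    \<forall>q :: complex. 0 < norm q \<and> norm q < 1 \<and> (\<forall>k::nat. k \<ge> 1 \<longrightarrow> q powr (of_nat k + \<nu>) \<noteq> 1) \<longrightarrow>
      (\<lambda>m. let n = Suc m in
         fps_const (eval3 (N n) q (q powr \<nu>) (q_number q \<nu>) / D_denom \<nu> q n
                      * q powr ((\<nu> + 1) * of_nat (n - 1)))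
           * (fps_const (1 / 2) * fps_X) ^ (2 * n - 1))
      sums (jackson1_ratio \<nu> q oo (fps_const (1 - q) * fps_X))"
proof -
  \<comment> \<open>The numerators are chosen before \<open>q\<close>, so one family of polynomials
    serves every admissible \<open>q\<close>.\<close>
  obtain N where N: "\<And>n x y t. eval3 (N n) x y t = kishore_num n x t"
    using nat_poly3_kishore_num unfolding nat_poly3_def by metis
  show ?thesis
  proof (intro exI[of _ N] allI impI)
    fix q :: complex
    assume q: "0 < norm q \<and> norm q < 1 \<and> (\<forall>k::nat. k \<ge> 1 \<longrightarrow> q powr (of_nat k + \<nu>) \<noteq> 1)"
    then have q0: "q \<noteq> 0" and q1: "norm q < 1" and qn1: "q \<noteq> 1" by auto
    define a where "a = q powr (\<nu> + 1)"
    define t where "t = q_number q \<nu>"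
    have aq: "a * q ^ i = q powr (of_nat (Suc i) + \<nu>)" for i
      using q0 by (simp add: a_def powr_add powr_nat' mult_ac)
    have a: "a * q ^ i \<noteq> 1" for i
      unfolding aq using q by (simp del: of_nat_Suc)
    have a0: "a \<noteq> 0" using q0 by (simp add: a_def)
    have a1: "1 - a \<noteq> 0" using a[of 0] by simp
    have shift: "q_shift j q t = q_number q (of_nat j + \<nu>)" for j
      using q_shift_q_number[OF q0 qn1] by (simp add: t_def)
    have shift_Suc: "q_shift (Suc m) q t = (1 - a * q ^ m) / (1 - q)" for m
      unfolding shift q_number_def aq ..
    define R where "R = bessel_ratio a q"
    define \<kappa> where "\<kappa> = - ((1 - q)^2)"
    \<comment> \<open>\<open>c m\<close> is the coefficient of (z/2)^(2m+1). Below, \<open>b\<close>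
      counts from 1 and has the power of \<open>a\<close> removed, giving the normalisation in which
      the recurrence takes its stated form.\<close>
    define c where "c = (\<lambda>m. (1 - q) / (1 - a) * (\<kappa> ^ m * R $ m))"
    define b where "b = (\<lambda>n. c (n - 1) / a ^ (n - 1))"
    have b: "b n = kishore_num n q t / (\<Prod>k=1..n. q_shift k q t ^ (n div k))" if "n \<ge> 1" for n
    proof (rule kishore_recurrence[OF _ _ _ that])
      fix j :: nat assume "j \<ge> 1"
      then obtain i where "j = Suc i" by (cases j) auto
      then show "q_shift j q t \<noteq> 0"
        using a[of i] qn1 by (simp add: shift_Suc)
    next
      show "q_shift 1 q t * b 1 = 1"
        using shift_Suc[of 0] qn1 a1 bessel_ratio_nth_0[OF q0 q1 a]
        by (simp add: b_def c_def R_def)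
    next
      fix n :: nat assume "n \<ge> 2"
      then obtain m where n: "n = Suc (Suc m)" by (metis Suc_le_D numeral_2_eq_2 Suc_le_mono)
      define S where "S = (\<Sum>i=0..m. q ^ (m - i) * R $ i * R $ (m - i))"
      have rec: "(1 - a * q ^ Suc m) * R $ Suc m = - (a / (1 - a)) * S"
        using bessel_ratio_nth_Suc[OF q0 q1 a] by (simp add: R_def S_def)
      have "q_shift n q t * b n
          = \<kappa> ^ Suc m / ((1 - a) * a ^ Suc m) * ((1 - a * q ^ Suc m) * R $ Suc m)"
        unfolding n shift_Suc b_def c_def using qn1 by simp
      \<comment> \<open>One factor \<open>\<kappa>\<close> supplies (1-q)^2 and a sign that cancels
        the minus from the Riccati equation; one power of \<open>a\<close> cancels too. The
        prefactor then splits evenly between the two factors \<open>b\<close>.\<close>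
      also have "\<dots> = (1 - q)^2 / (1 - a)^2 * (\<kappa> ^ m / a ^ m) * S"
      proof -
        have "(w * K) / ((1 - a) * (a * A)) * (- (a / (1 - a)) * S) = - w / (1 - a)^2 * (K / A) * S"
          for w K A :: complex
          using a0 by (simp add: power2_eq_square divide_inverse mult_ac)
        from this[of \<kappa> "\<kappa> ^ m" "a ^ m"] show ?thesis
          unfolding rec unfolding power_Suc by (simp only: \<kappa>_def minus_minus)
      qed
      also have "\<dots> = (\<Sum>i=0..m. q ^ (m - i) * b (Suc i) * b (Suc (m - i)))"
        unfolding S_def sum_distrib_left
      proof (rule sum.cong[OF refl])
        fix i assume "i \<in> {0..m}"
        then have "\<kappa> ^ m = \<kappa> ^ i * \<kappa> ^ (m - i)" "a ^ m = a ^ i * a ^ (m - i)"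
          by (simp_all flip: power_add)
        then show "(1 - q)^2 / (1 - a)^2 * (\<kappa> ^ m / a ^ m) * (q ^ (m - i) * R $ i * R $ (m - i))
            = q ^ (m - i) * b (Suc i) * b (Suc (m - i))"
          by (simp add: b_def c_def power2_eq_square mult_ac)
      qed
      also have "\<dots> = (\<Sum>k\<in>{1..<n}. q ^ (n - k - 1) * b k * b (n - k))"
        by (rule sum.reindex_bij_witness[of _ "\<lambda>k. k - 1" Suc]) (auto simp: n Suc_diff_le)
      finally show "q_shift n q t * b n = (\<Sum>k\<in>{1..<n}. q ^ (n - k - 1) * b k * b (n - k))" .
    qed
    define H :: "complex fps" where "H = fps_const (1 / 2) * fps_X"
    have H0: "H $ 0 = 0" by (simp add: H_def)
    have coeff: "eval3 (N (Suc m)) q (q powr \<nu>) (q_number q \<nu>) / D_denom \<nu> q (Suc m)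
        * q powr ((\<nu> + 1) * of_nat m) = c m" for m
    proof -
      \<comment> \<open>A natural multiple in the exponent respects the principal branch.\<close>
      have "q powr ((\<nu> + 1) * of_nat m) = a ^ m"
        using q0 unfolding a_def by (simp add: powr_def exp_of_nat_mult[symmetric] mult_ac)
      moreover have "eval3 (N (Suc m)) q (q powr \<nu>) (q_number q \<nu>) / D_denom \<nu> q (Suc m) = b (Suc m)"
        using b[of "Suc m"] by (simp add: N D_denom_def shift t_def[symmetric])
      ultimately show ?thesis using a0 by (simp add: b_def)
    qed
    \<comment> \<open>The powers of \<open>\<kappa>\<close> in \<open>c\<close> amount to a dilation
      of \<open>R\<close>; substituting \<open>H^2\<close> then gives the argument found in
      \<open>jackson1_ratio_compose\<close>.\<close>
    have "Abs_fps c = fps_const ((1 - q) / (1 - a)) * (R oo (fps_const \<kappa> * fps_X))"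
      by (rule fps_ext) (simp add: c_def fps_compose_linear_nth)
    then have "Abs_fps c oo H^2 = fps_const ((1 - q) / (1 - a)) * (R oo (fps_const \<kappa> * H^2))"
      using H0 by (simp add: fps_compose_mult_distrib fps_compose_assoc[symmetric])
    then have "jackson1_ratio \<nu> q oo (fps_const (1 - q) * fps_X) = (Abs_fps c oo H^2) * H"
      using jackson1_ratio_compose[OF q0 q1, of \<nu>] a by (simp add: a_def R_def \<kappa>_def H_def)
    moreover have "fps_const (c m) * (H^2) ^ m * H = fps_const (c m) * H ^ (2 * Suc m - 1)" for m
    proof -
      have "H ^ (2 * Suc m - 1) = H ^ (2 * m) * H" by simp
      then show ?thesis by (simp only: power_mult mult.assoc)
    qed
    ultimately show "(\<lambda>m. let n = Suc m in
         fps_const (eval3 (N n) q (q powr \<nu>) (q_number q \<nu>) / D_denom \<nu> q n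
                      * q powr ((\<nu> + 1) * of_nat (n - 1)))
           * (fps_const (1 / 2) * fps_X) ^ (2 * n - 1))
      sums (jackson1_ratio \<nu> q oo (fps_const (1 - q) * fps_X))"
      using fps_sums_compose_mult[of "H^2" c H] H0
      by (simp only: Let_def coeff diff_Suc_1 H_def[symmetric] fps_nth_power_0) simp
  qed
qed

end
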